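(* Let $K\in\mathcal S^n_o$ and $\varphi\in\Phi$. Consider the two problems: Problem $\mathrm P_2$: among all $E\in\mathcal E^n$ with $V(E)\le\omega_n$, minimize $O_\varphi(K,E)$. Problem $\mathrm P_3$: among all $E\in\mathcal E^n$ with $O_\varphi(K,E)\le 1$, maximize $\left(\frac{\omega_n}{V(E)}\right)^{1/n}$. Then: (1) If $E_0$ is the unique solution to Problem $\mathrm P_2$, then $O_\varphi(K,E_0)E_0$ is a solution to Problem $\mathrm P_3$. (2) If $E_1$ is a solution to Problem $\mathrm P_3$, then $\left(\frac{\omega_n}{V(E_1)}\right)^{1/n}E_1$ is a solution to Problem $\mathrm P_2$. Consequently, there exists a unique solution to Problem $\mathrm P_3$.
   Context: Work in $\mathbb R^n$; $V$ is volume, $B$ the Euclidean unit ball, $\omega_n=V(B)$, $S$ spherical Lebesgue measure on the unit sphere $S^{n-1}$. $\Phi$ is the class of convex, strictly increasing functions $\varphi:[0,\infty)\to[0,\infty)$ with $\varphi(0)=0$. For a compact set $K$ that is star-shaped about the origin, the radial function is $\rho_K(x)=\sup\{\lambda\ge0:\lambda x\in K\}$, $x\ne o$; $\mathcal S^n_o$ is the class of star bodies about the origin $o$, i.e. compact sets $K$ with $\lambda x\in K$ for all $x\in K,\lambda\in[0,1]$, with $o\in\operatorname{int}K$ and $\rho_K$ continuous on $S^{n-1}$. $\mathcal E^n$ is the class of (nondegenerate, $n$-dimensional) origin-symmetric ellipsoids. $V_K^*$ is the probability measure on $S^{n-1}$ with $dV_K^*=\frac{\rho_K^n}{nV(K)}\,dS$.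 For $K,L\in\mathcal S^n_o$, $$O_\varphi(K,L)=\inf\left\{\lambda>0:\ \varphi^{-1}\left(\int_{S^{n-1}}\varphi\left(\frac{\rho_K}{\lambda\rho_L}\right)dV_K^*\right)\le1\right\}.$$ Problem $\mathrm P_2$ has a unique solution. *)

theory Defs
  imports "HOL-Analysis.Analysis"
begin

definition Phi_class :: "(real \<Rightarrow> real) set" where
  "Phi_class = {\<phi>. \<phi> \<in> {0..} \<rightarrow> {0..} \<and> convex_on {0..} \<phi> \<and> strict_mono_on {0..} \<phi> \<and> \<phi> 0 = 0}"

abbreviation vol :: "(real ^ 'n) set \<Rightarrow> real" where
  "vol A \<equiv> measure lebesgue A"

definition unit_ball_vol :: "'n::finite itself \<Rightarrow> real" where
  "unit_ball_vol _ = vol (cball (0 :: real ^ 'n) 1)"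

definition radial_fun :: "(real ^ 'n) set \<Rightarrow> real ^ 'n \<Rightarrow> real" where
  "radial_fun K x = Sup {l. 0 \<le> l \<and> l *\<^sub>R x \<in> K}"

definition star_bodies :: "(real ^ 'n) set set" where
  "star_bodies = {K. compact K \<and> (\<forall>x\<in>K. \<forall>l\<in>{0..1}. l *\<^sub>R x \<in> K) \<and>
     0 \<in> interior K \<and> continuous_on (sphere 0 1) (radial_fun K)}"

definition ellipsoids :: "(real ^ 'n) set set" where
  "ellipsoids = {E. \<exists>A :: real ^ 'n ^ 'n. invertible A \<and> E = (\<lambda>x. A *v x) ` cball 0 1}"

text \<open>The measure of a Borel set A of unit vectors is n times the Lebesgue measure of the
  cone {r u | u in A, 0 < r < 1}, which is the preimage of A under normalisation of the
  punctured open unit ball.\<close>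

definition spherical_measure :: "(real ^ 'n) measure" where
  "spherical_measure = scale_measure (of_nat CARD('n))
     (distr (restrict_space lborel (ball 0 1 - {0})) (restrict_space borel (sphere 0 1)) sgn)"

definition dual_cone_measure :: "(real ^ 'n) set \<Rightarrow> (real ^ 'n) measure" where
  "dual_cone_measure K = density spherical_measure
     (\<lambda>u. ennreal (radial_fun K u ^ CARD('n) / (real CARD('n) * vol K)))"

text \<open>Every member of \<^const>\<open>Phi_class\<close> is a bijection of the half-line onto itself, so the
  inverse below is taken on all of it.\<close>

definition orlicz_functional ::
    "(real \<Rightarrow> real) \<Rightarrow> (real ^ 'n) set \<Rightarrow> (real ^ 'n) set \<Rightarrow> real" where
  "orlicz_functional \<phi> K L = Inf {l. l > 0 \<and>
     inv_into {0..} \<phi>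
       (\<integral>u. \<phi> (radial_fun K u / (l * radial_fun L u)) \<partial>dual_cone_measure K) \<le> 1}"

definition solves_P2 :: "(real \<Rightarrow> real) \<Rightarrow> (real ^ 'n) set \<Rightarrow> (real ^ 'n) set \<Rightarrow> bool" where
  "solves_P2 \<phi> K E \<longleftrightarrow>
     E \<in> ellipsoids \<and> vol E \<le> unit_ball_vol TYPE('n) \<and>
     (\<forall>F\<in>ellipsoids. vol F \<le> unit_ball_vol TYPE('n) \<longrightarrow>
        orlicz_functional \<phi> K E \<le> orlicz_functional \<phi> K F)"

definition vol_ratio :: "(real ^ 'n) set \<Rightarrow> real" where
  "vol_ratio E = root CARD('n) (unit_ball_vol TYPE('n) / vol E)"

definition solves_P3 :: "(real \<Rightarrow> real) \<Rightarrow> (real ^ 'n) set \<Rightarrow> (real ^ 'n) set \<Rightarrow> bool" where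
  "solves_P3 \<phi> K E \<longleftrightarrow>
     E \<in> ellipsoids \<and> orlicz_functional \<phi> K E \<le> 1 \<and>
     (\<forall>F\<in>ellipsoids. orlicz_functional \<phi> K F \<le> 1 \<longrightarrow> vol_ratio F \<le> vol_ratio E)"

end

theory Submission
  imports Defs
begin

text \<open>
  An ellipsoid is \<open>{x. |T x| \<le> 1}\<close> for an invertible matrix \<open>T\<close>, determined up to left multiplication by an
  orthogonal matrix, and \<open>O\<^sub>\<phi>(K, E) \<le> 1\<close> holds iff \<open>G(T) = \<integral> \<phi>(\<rho>\<^sub>K(u) |T u|) dV\<^sub>K\<^sup>*(u)\<close> is at most
  \<open>\<phi>(1)\<close>. So Problem \<open>P\<^sub>3\<close> maximises \<open>|det T|\<close> over \<open>{G \<le> \<phi>(1)}\<close>. The function \<open>G\<close> is convex, hence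
  continuous, and coercive, so this set is compact and a maximiser exists. If \<open>T\<^sub>1\<close> and \<open>T\<^sub>2\<close> are
  maximisers, the singular value decomposition of \<open>T\<^sub>2 T\<^sub>1\<^sup>-\<^sup>1\<close> yields an orthogonal \<open>Q\<close> such that the
  midpoint of \<open>T\<^sub>1\<close> and \<open>Q T\<^sub>2\<close>, which is again admissible, has a strictly larger determinant unless
  \<open>T\<^sub>2 T\<^sub>1\<^sup>-\<^sup>1\<close> is orthogonal. The passage between \<open>P\<^sub>2\<close> and \<open>P\<^sub>3\<close> is the scaling
  \<open>O\<^sub>\<phi>(K, c E) = O\<^sub>\<phi>(K, E) / c\<close>.
\<close>

section \<open>Singular values and determinants\<close>

lemma continuous_on_matrix_matrix_mult:
  fixes f :: "'a::topological_space \<Rightarrow> real^'n^'m" and g :: "'a \<Rightarrow> real^'k^'n"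
  assumes "continuous_on S f" "continuous_on S g"
  shows "continuous_on S (\<lambda>x. f x ** g x)"
  unfolding matrix_matrix_mult_def using assms
  by (auto intro!: continuous_intros)

lemma matrix_mult_add_rdistrib:
  fixes A B :: "'a::semiring_1^'n^'m"
  shows "(A + B) ** C = A ** C + B ** C"
  by (simp add: matrix_matrix_mult_def vec_eq_iff distrib_right sum.distrib)

lemma continuous_on_transpose:
  fixes f :: "'a::topological_space \<Rightarrow> real^'n^'m"
  assumes "continuous_on S f"
  shows "continuous_on S (\<lambda>x. transpose (f x))"
  unfolding transpose_def using assms by (auto intro!: continuous_intros)

lemma continuous_on_det:
  fixes f :: "'a::topological_space \<Rightarrow> real^'n^'n"
  assumes "continuous_on S f"
  shows "continuous_on S (\<lambda>x. det (f x))"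
  unfolding det_def using assms by (auto intro!: continuous_intros)

text \<open>Orthonormal rows bound the norm, and the defining equation is closed. Compactness makes
  the maximisation behind \<open>singular_value_decomposition\<close> possible.\<close>

lemma compact_orthogonal_matrices: "compact {Q :: real^'n^'n. orthogonal_matrix Q}"
  unfolding compact_eq_bounded_closed
proof
  have "norm Q \<le> real CARD('n)" if "orthogonal_matrix Q" for Q :: "real^'n^'n"
  proof -
    have "norm (Q $ i) = 1" for i
      using that unfolding orthogonal_matrix_orthonormal_rows by (simp add: row_def)
    moreover have "norm Q \<le> (\<Sum>i\<in>UNIV. norm (Q $ i))"
      unfolding norm_vec_def by (rule L2_set_le_sum) auto
    ultimately show ?thesis by simp
  qed
  then show "bounded {Q :: real^'n^'n. orthogonal_matrix Q}"
    unfolding bounded_iff by blast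
  have "closed {Q :: real^'n^'n. transpose Q ** Q = mat 1}"
    by (intro closed_Collect_eq continuous_on_matrix_matrix_mult continuous_on_transpose
        continuous_intros)
  then show "closed {Q :: real^'n^'n. orthogonal_matrix Q}"
    by (simp add: orthogonal_matrix)
qed

lemma norm_orthogonal_matrix_mult:
  fixes Q :: "real^'n^'n"
  assumes "orthogonal_matrix Q"
  shows "norm (Q *v x) = norm x"
  using assms by (intro orthogonal_transformation_norm[of "(*v) Q"])
    (simp add: orthogonal_transformation_matrix)

text \<open>For \<open>c\<^sup>2 + s\<^sup>2 = 1\<close> and distinct \<open>i\<close>,
  \<open>j\<close> this is the rotation with cosine \<open>c\<close> and sine \<open>s\<close> in
  the plane of these two coordinates. It is written as the identity plus a correction, so that a sum
  over all coordinates changes in two terms only.\<close>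

definition plane_rotation :: "'n::finite \<Rightarrow> 'n \<Rightarrow> real \<Rightarrow> real \<Rightarrow> real^'n \<Rightarrow> real^'n" where
  "plane_rotation i j c s x = x + ((c - 1) * x $ i - s * x $ j) *\<^sub>R axis i 1
     + (s * x $ i + (c - 1) * x $ j) *\<^sub>R axis j 1"

lemma orthogonal_transformation_plane_rotation:
  fixes i j :: "'n::finite"
  assumes "i \<noteq> j" "c\<^sup>2 + s\<^sup>2 = 1"
  shows "orthogonal_transformation (plane_rotation i j c s)"
  unfolding orthogonal_transformation
proof (intro conjI allI)
  show "linear (plane_rotation i j c s)"
    by (rule linearI) (simp_all add: plane_rotation_def algebra_simps)
  fix x :: "real^'n"
  define a where "a = (c - 1) * x $ i - s * x $ j"
  define b where "b = s * x $ i + (c - 1) * x $ j"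
  have axis_other: "axis i (1::real) $ j = 0" "axis j (1::real) $ i = 0"
    using assms(1) by (auto simp: axis_def)
  have "plane_rotation i j c s x \<bullet> plane_rotation i j c s x
      = x \<bullet> x + 2 * a * x $ i + 2 * b * x $ j + a\<^sup>2 + b\<^sup>2"
    unfolding plane_rotation_def a_def[symmetric] b_def[symmetric]
    using assms(1) axis_other
    by (simp add: inner_add_left inner_add_right inner_axis inner_axis' inner_axis_axis power2_eq_square
        algebra_simps)
  also have "2 * a * x $ i + 2 * b * x $ j + a\<^sup>2 + b\<^sup>2 = (c\<^sup>2 + s\<^sup>2 - 1) * ((x $ i)\<^sup>2 + (x $ j)\<^sup>2)"
    unfolding a_def b_def by (simp add: power2_eq_square algebra_simps)
  then have "x \<bullet> x + 2 * a * x $ i + 2 * b * x $ j + a\<^sup>2 + b\<^sup>2 = x \<bullet> x"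
    using assms(2) by simp
  finally show "norm (plane_rotation i j c s x) = norm x"
    by (simp add: norm_eq)
qed

text \<open>First-order condition at a maximum along the plane rotations.\<close>

lemma weighted_trace_max_imp_eq:
  fixes M :: "real^'n^'n" and w :: "'n \<Rightarrow> real"
  assumes max: "\<And>Q. orthogonal_matrix Q \<Longrightarrow> (\<Sum>k\<in>UNIV. w k * (Q ** M) $ k $ k) \<le> (\<Sum>k\<in>UNIV. w k * M $ k $ k)"
    and "i \<noteq> j"
  shows "w i * M $ j $ i = w j * M $ i $ j"
proof (rule ccontr)
  assume ne: "w i * M $ j $ i \<noteq> w j * M $ i $ j"
  \<comment> \<open>A rotation with parameters \<open>c\<close>, \<open>s\<close> changes the
    weighted trace by \<open>c * a + s * b - a\<close>. On the unit circle
    \<open>c * a + s * b\<close> is largest at \<open>(a, b) / r\<close>, where it equals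
    \<open>r\<close>; this exceeds \<open>a\<close> as soon as \<open>b\<close> is nonzero.\<close>
  define a where "a = w i * M $ i $ i + w j * M $ j $ j"
  define b where "b = w j * M $ i $ j - w i * M $ j $ i"
  define r where "r = sqrt (a\<^sup>2 + b\<^sup>2)"
  have "b \<noteq> 0" using ne by (simp add: b_def)
  then have pos: "a\<^sup>2 + b\<^sup>2 > 0" by (simp add: sum_power2_gt_zero_iff)
  then have r: "r > 0" "r\<^sup>2 = a\<^sup>2 + b\<^sup>2"
    unfolding r_def by (rule real_sqrt_gt_zero, intro real_sqrt_pow2 less_imp_le)
  define c where "c = a / r"
  define s where "s = b / r"
  have cs: "c\<^sup>2 + s\<^sup>2 = 1"
    unfolding c_def s_def power_divide r(2)[symmetric] add_divide_distrib[symmetric]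
    using r(1) by simp
  define f where "f = plane_rotation i j c s"
  have f: "orthogonal_transformation f"
    unfolding f_def by (rule orthogonal_transformation_plane_rotation[OF \<open>i \<noteq> j\<close> cs])
  then have lin: "linear f" and Q: "orthogonal_matrix (matrix f)"
    using orthogonal_transformation_matrix by blast+
  have "(matrix f ** M) $ k $ k = f (column k M) $ k" for k
    using matrix_vector_mul(2)[OF lin, THEN fun_cong, of "column k M"]
    by (simp add: matrix_matrix_mult_def matrix_vector_mult_def column_def vec_eq_iff)
  moreover have "w k * f (column k M) $ k = w k * M $ k $ k
      + (if k = i then w i * ((c - 1) * M $ i $ i - s * M $ j $ i) else 0)
      + (if k = j then w j * (s * M $ i $ j + (c - 1) * M $ j $ j) else 0)" for k
    using \<open>i \<noteq> j\<close> by (auto simp: f_def plane_rotation_def axis_def column_def algebra_simps)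
  ultimately have eq: "w k * (matrix f ** M) $ k $ k = w k * M $ k $ k
      + (if k = i then w i * ((c - 1) * M $ i $ i - s * M $ j $ i) else 0)
      + (if k = j then w j * (s * M $ i $ j + (c - 1) * M $ j $ j) else 0)" for k
    by simp
  have "(\<Sum>k\<in>UNIV. w k * (matrix f ** M) $ k $ k) = (\<Sum>k\<in>UNIV. w k * M $ k $ k)
      + w i * ((c - 1) * M $ i $ i - s * M $ j $ i) + w j * (s * M $ i $ j + (c - 1) * M $ j $ j)"
    unfolding eq sum.distrib by simp
  with max[OF Q] have "c * a + s * b \<le> a"
    by (simp add: a_def b_def algebra_simps)
  moreover have "c * a + s * b = r"
    using r by (simp add: c_def s_def power2_eq_square field_simps)
  ultimately have "r \<le> a" by simp
  with r(1) have "r\<^sup>2 \<le> a\<^sup>2" by (intro power_mono) auto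
  with r \<open>b \<noteq> 0\<close> show False by simp
qed

text \<open>Maximise the trace of \<open>U ** S ** V\<close>, weighted by distinct positive weights,
  over pairs of orthogonal matrices. The first-order conditions for rotations from the left and from
  the right are two linear equations for \<open>M $ i $ j\<close> and \<open>M $ j $ i\<close>, with
  only the zero solution. Signs on the diagonal are corrected afterwards.\<close>

theorem singular_value_decomposition:
  fixes S :: "real^'n^'n"
  obtains U V :: "real^'n^'n" where "orthogonal_matrix U" "orthogonal_matrix V"
    "\<And>i j. i \<noteq> j \<Longrightarrow> (U ** S ** V) $ i $ j = 0"
    "\<And>i. (U ** S ** V) $ i $ i \<ge> 0"
proof -
  obtain g :: "'n \<Rightarrow> nat" where g: "inj g"
    using finite_imp_inj_to_nat_seg[of "UNIV :: 'n set"] by blast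
  \<comment> \<open>Injectivity of \<open>g\<close> makes the weights distinct; the added 1 makes
    them positive, so that their squares are distinct as well.\<close>
  define w where "w i = real (g i) + 1" for i
  have w: "w i > 0" "w i = w j \<longleftrightarrow> i = j" for i j
    using g by (auto simp: w_def inj_eq)
  let ?O = "{Q :: real^'n^'n. orthogonal_matrix Q}"
  let ?f = "\<lambda>(U, V). \<Sum>k\<in>UNIV. w k * (U ** S ** V) $ k $ k"
  have "continuous_on (?O \<times> ?O) ?f"
    unfolding case_prod_unfold
    by (intro continuous_on_matrix_matrix_mult continuous_intros)
  moreover have "?O \<times> ?O \<noteq> {}" using orthogonal_matrix_id by blast
  ultimately obtain p where p: "p \<in> ?O \<times> ?O" "\<And>q. q \<in> ?O \<times> ?O \<Longrightarrow> ?f q \<le> ?f p"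
    using continuous_attains_sup[of "?O \<times> ?O" ?f]
      compact_Times[OF compact_orthogonal_matrices compact_orthogonal_matrices] by blast
  obtain U V where UV: "p = (U, V)" by fastforce
  have U: "orthogonal_matrix U" and V: "orthogonal_matrix V" using p(1) UV by auto
  define M where "M = U ** S ** V"
  have left: "(\<Sum>k\<in>UNIV. w k * (Q ** M) $ k $ k) \<le> (\<Sum>k\<in>UNIV. w k * M $ k $ k)"
    if "orthogonal_matrix Q" for Q
    using p(2)[of "(Q ** U, V)"] that U V
    by (simp add: UV M_def orthogonal_matrix_mul matrix_mul_assoc)
  \<comment> \<open>Multiplying \<open>V\<close> by \<open>transpose Q\<close> on the right is, as
    far as the diagonal is concerned, multiplying \<open>transpose M\<close> by \<open>Q\<close> on
    the left, so the same first-order lemma applies to the transpose.\<close>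
  have right: "(\<Sum>k\<in>UNIV. w k * (Q ** transpose M) $ k $ k) \<le> (\<Sum>k\<in>UNIV. w k * transpose M $ k $ k)"
    if Q: "orthogonal_matrix Q" for Q
  proof -
    have "(Q ** transpose M) $ k $ k = (M ** transpose Q) $ k $ k" for k
      by (simp add: matrix_matrix_mult_def transpose_def mult.commute)
    moreover have "transpose M $ k $ k = M $ k $ k" for k by (simp add: transpose_def)
    ultimately show ?thesis
      using p(2)[of "(U, V ** transpose Q)"] Q U V
      by (simp add: UV M_def orthogonal_matrix_mul matrix_mul_assoc)
  qed
  have off: "M $ i $ j = 0" if "i \<noteq> j" for i j
  proof -
    have "w i * M $ j $ i = w j * M $ i $ j"
      by (rule weighted_trace_max_imp_eq[OF left that])
    moreover have "w i * M $ i $ j = w j * M $ j $ i"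
      using weighted_trace_max_imp_eq[OF right that] by (simp add: transpose_def)
    ultimately have "((w i)\<^sup>2 - (w j)\<^sup>2) * M $ i $ j = 0"
      by (simp add: power2_eq_square algebra_simps)
    moreover have "(w i)\<^sup>2 \<noteq> (w j)\<^sup>2"
      using w[of i] w[of j] that by (simp add: power2_eq_iff)
    ultimately show ?thesis by simp
  qed
  \<comment> \<open>\<open>D\<close> is a diagonal matrix of signs that flips the rows of
    \<open>M\<close> with a negative diagonal entry. It is symmetric and its own inverse, hence
    orthogonal, and can be absorbed into \<open>U\<close>.\<close>
  define D :: "real^'n^'n" where
    "D = (\<chi> i j. if i = j then (if M $ i $ i < 0 then -1 else 1) else 0)"
  have D: "(D ** A) $ i $ j = (if M $ i $ i < 0 then -1 else 1) * A $ i $ j" for A :: "real^'n^'n" and i j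
    by (simp add: D_def matrix_matrix_mult_def if_distrib[of "\<lambda>x. x * _"] cong: if_cong)
  have "transpose D = D" by (auto simp: D_def transpose_def vec_eq_iff)
  moreover have "D ** D = mat 1"
    unfolding vec_eq_iff by (auto simp: D) (auto simp: D_def mat_def)
  ultimately have oD: "orthogonal_matrix D" by (simp add: orthogonal_matrix)
  have DUSV: "D ** U ** S ** V = D ** M" by (simp add: M_def matrix_mul_assoc)
  show ?thesis
  proof (rule that)
    show "orthogonal_matrix (D ** U)" "orthogonal_matrix V"
      using oD U V by (auto simp: orthogonal_matrix_mul)
    show "(D ** U ** S ** V) $ i $ j = 0" if "i \<noteq> j" for i j
      using off[OF that] by (simp add: DUSV D)
    show "(D ** U ** S ** V) $ i $ i \<ge> 0" for i
      by (simp add: DUSV D)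
  qed
qed

text \<open>This is the strict log-concavity of the determinant at a midpoint.\<close>

lemma det_midpoint_gt:
  fixes S :: "real^'n^'n"
  assumes "\<bar>det S\<bar> = 1" "\<not> orthogonal_matrix S"
  obtains Q where "orthogonal_matrix Q" "\<bar>det ((1/2) *\<^sub>R (mat 1 + Q ** S))\<bar> > 1"
proof -
  obtain U V where U: "orthogonal_matrix U" and V: "orthogonal_matrix V"
    and off: "\<And>i j. i \<noteq> j \<Longrightarrow> (U ** S ** V) $ i $ j = 0"
    and nn: "\<And>i. (U ** S ** V) $ i $ i \<ge> 0"
    by (rule singular_value_decomposition[of S]) blast
  define M where "M = U ** S ** V"
  define d where "d i = M $ i $ i" for i
  have det_orth: "\<bar>det Q\<bar> = 1" if "orthogonal_matrix Q" for Q :: "real^'n^'n"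
    using det_orthogonal_matrix[OF that] by auto
  have detM: "(\<Prod>i\<in>UNIV. d i) = det M"
    unfolding d_def using off by (subst det_diagonal) (auto simp: M_def)
  have abs1: "\<bar>det M\<bar> = 1"
    using assms(1) det_orth[OF U] det_orth[OF V] by (simp add: M_def det_mul abs_mult)
  have dnn: "d i \<ge> 0" for i using nn by (simp add: d_def M_def)
  have "(\<Prod>i\<in>UNIV. d i) \<ge> 0" using dnn by (simp add: prod_nonneg)
  with abs1 detM have prod1: "(\<Prod>i\<in>UNIV. d i) = 1" by simp
  then have dpos: "d i > 0" for i
    using dnn[of i] by (metis finite UNIV_I less_eq_real_def prod_zero zero_neq_one)
  have VV: "V ** transpose V = mat 1" "transpose V ** V = mat 1"
    using V by (auto simp: orthogonal_matrix_def)
  have "transpose U ** M ** transpose V = (transpose U ** U) ** S ** (V ** transpose V)"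
    by (simp add: M_def matrix_mul_assoc)
  then have S: "S = transpose U ** M ** transpose V"
    using U VV by (simp add: orthogonal_matrix)
  have "\<exists>i. d i \<noteq> 1"
  proof (rule ccontr)
    assume "\<not> (\<exists>i. d i \<noteq> 1)"
    then have "M = mat 1" using off by (auto simp: vec_eq_iff mat_def d_def M_def)
    then have "orthogonal_matrix S"
      using S U V by (auto simp: orthogonal_matrix_mul)
    with assms(2) show False by simp
  qed
  then obtain i0 where i0: "d i0 \<noteq> 1" by blast
  \<comment> \<open>The inequality of arithmetic and geometric means for \<open>1\<close> and
    \<open>x\<close>, squared and with its defect made explicit: equality holds only at
    \<open>x = 1\<close>. Taken over all singular values, it compares their product 1 with the
    squared determinant of the midpoint.\<close>
  have diff: "((1 + x) / 2)\<^sup>2 - x = ((1 - x) / 2)\<^sup>2" for x :: real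
    by (simp add: power2_eq_square field_simps)
  have le: "d i \<le> ((1 + d i) / 2)\<^sup>2" for i
    using diff[of "d i"] zero_le_power2[of "(1 - d i) / 2"] by linarith
  have "((1 - d i0) / 2)\<^sup>2 > 0" using i0 by simp
  then have "d i0 < ((1 + d i0) / 2)\<^sup>2"
    using diff[of "d i0"] by linarith
  moreover have mpos: "((1 + d i) / 2)\<^sup>2 > 0" for i
    using le[of i] dpos[of i] by linarith
  ultimately have "(\<Prod>i\<in>UNIV. d i) < (\<Prod>i\<in>UNIV. ((1 + d i) / 2)\<^sup>2)"
    using dnn le mpos by (intro prod_mono_strict[of i0]) auto
  then have gt: "1 < (\<Prod>i\<in>UNIV. (1 + d i) / 2)\<^sup>2"
    using prod1 by (simp add: prod_power_distrib)
  have nonneg: "(\<Prod>i\<in>UNIV. (1 + d i) / 2) \<ge> 0"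
    using dnn by (intro prod_nonneg) (auto simp: add_nonneg_nonneg)
  have "(\<Prod>i\<in>UNIV. (1 + d i) / 2) > 1"
    using gt nonneg by (metis one_power2 power2_less_imp_less)
  moreover have "det ((1/2) *\<^sub>R (mat 1 + M)) = (\<Prod>i\<in>UNIV. (1 + d i) / 2)"
    using off by (subst det_diagonal) (auto simp: M_def d_def mat_def)
  \<comment> \<open>The choice is \<open>Q = V ** U\<close>: it turns \<open>S\<close> into
    \<open>V ** M ** transpose V\<close>, the symmetric factor of its polar decomposition, so that
    adding the identity acts on the singular values alone.\<close>
  moreover have "(1/2) *\<^sub>R (mat 1 + V ** U ** S) = V ** ((1/2) *\<^sub>R (mat 1 + M)) ** transpose V"
  proof -
    have "V ** M ** transpose V = V ** U ** S ** (V ** transpose V)"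
      by (simp add: M_def matrix_mul_assoc)
    then have "V ** U ** S = V ** M ** transpose V" using VV by simp
    then have "mat 1 + V ** U ** S = V ** (mat 1 + M) ** transpose V"
      using VV(1) by (simp add: matrix_add_ldistrib matrix_mult_add_rdistrib)
    then show ?thesis by (simp add: matrix_scalar_ac scalar_matrix_assoc)
  qed
  ultimately have "\<bar>det ((1/2) *\<^sub>R (mat 1 + V ** U ** S))\<bar> > 1"
    using det_orth[OF V] by (simp add: det_mul abs_mult)
  then show ?thesis using that U V by (blast intro: orthogonal_matrix_mul)
qed

section \<open>Lebesgue measure under orthogonal maps\<close>

text \<open>The library states this for \<open>real^'n\<close> with a well-ordered index type only. Balls are mapped to
  balls, so Vitali's covering theorem gives the general case.\<close>

lemma emeasure_orthogonal_image_open: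
  fixes f :: "'a::euclidean_space \<Rightarrow> 'a"
  assumes f: "orthogonal_transformation f" and "open S"
  shows "emeasure lebesgue (f ` S) = emeasure lebesgue S"
proof -
  let ?K = "{p :: 'a \<times> real. ball (fst p) (snd p) \<subseteq> S}"
  have "\<exists>p. p \<in> ?K \<and> x \<in> ball (fst p) (snd p) \<and> snd p < d" if x: "x \<in> S" "0 < d" for x d
  proof -
    obtain e where e: "e > 0" "ball x e \<subseteq> S" using \<open>open S\<close> x openE by blast
    let ?p = "(x, min e (d / 2))"
    have "?p \<in> ?K \<and> x \<in> ball (fst ?p) (snd ?p) \<and> snd ?p < d" using e x by auto
    then show ?thesis by blast
  qed
  then obtain C where C: "countable C" "C \<subseteq> ?K"
      "pairwise (\<lambda>i j. disjnt (ball (fst i) (snd i)) (ball (fst j) (snd j))) C"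
      "negligible (S - (\<Union>i \<in> C. ball (fst i) (snd i)))"
    by (rule Vitali_covering_theorem_balls[of S ?K fst snd]) blast
  define U where "U = (\<Union>i \<in> C. ball (fst i) (snd i))"
  have lin: "linear f" and inj: "inj f"
    using f orthogonal_transformation_linear orthogonal_transformation_inj by blast+
  have S: "S = U \<union> (S - U)" using C(2) by (auto simp: U_def)
  have fU: "f ` U = (\<Union>i \<in> C. ball (f (fst i)) (snd i))"
    by (simp add: U_def image_UN image_orthogonal_transformation_ball[OF f])
  have "negligible (S - U)" using C(4) by (simp add: U_def)
  moreover from this have "negligible (f ` (S - U))"
    using lin by (intro negligible_differentiable_image_negligible linear_imp_differentiable_on) auto
  ultimately have null: "S - U \<in> null_sets lebesgue" "f ` (S - U) \<in> null_sets lebesgue"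
    by (simp_all add: negligible_iff_null_sets)
  have disj: "disjoint_family_on (\<lambda>i. ball (fst i) (snd i)) C"
    using C(3) by (auto simp: disjoint_family_on_def pairwise_def disjnt_def)
  have disj': "disjoint_family_on (\<lambda>i. ball (f (fst i)) (snd i)) C"
    unfolding disjoint_family_on_def
  proof (intro ballI impI)
    fix i j assume "i \<in> C" "j \<in> C" "i \<noteq> j"
    then have "ball (fst i) (snd i) \<inter> ball (fst j) (snd j) = {}"
      using disj by (auto simp: disjoint_family_on_def)
    then have "f ` ball (fst i) (snd i) \<inter> f ` ball (fst j) (snd j) = {}"
      using image_Int[OF inj] by (metis image_empty)
    then show "ball (f (fst i)) (snd i) \<inter> ball (f (fst j)) (snd j) = {}"
      by (simp add: image_orthogonal_transformation_ball[OF f])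
  qed
  have ball: "emeasure lebesgue (ball (f a) r) = emeasure lebesgue (ball a r)" for a r
    by (cases "r \<ge> 0") (simp_all add: emeasure_ball ball_empty)
  have "emeasure lebesgue (f ` S) = emeasure lebesgue (f ` U \<union> f ` (S - U))"
    using S by (metis image_Un)
  also have "\<dots> = emeasure lebesgue (f ` U)"
    using null(2) by (intro emeasure_Un_null_set) (auto simp: fU intro!: lborelD borel_open)
  also have "\<dots> = (\<integral>\<^sup>+i. emeasure lebesgue (ball (f (fst i)) (snd i)) \<partial>count_space C)"
    unfolding fU using C(1) disj' by (intro emeasure_UN_countable) auto
  also have "\<dots> = (\<integral>\<^sup>+i. emeasure lebesgue (ball (fst i) (snd i)) \<partial>count_space C)"
    by (simp add: ball)
  also have "\<dots> = emeasure lebesgue U"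
    unfolding U_def using C(1) disj by (intro emeasure_UN_countable[symmetric]) auto
  also have "\<dots> = emeasure lebesgue (U \<union> (S - U))"
    using null(1) by (intro emeasure_Un_null_set[symmetric]) (auto simp: U_def intro!: lborelD borel_open)
  finally show ?thesis using S by simp
qed

text \<open>The complement of \<open>S\<close> in a large centred ball is open, and the ball is
  invariant under \<open>f\<close>. The open case applied to this complement gives the claim by
  subtraction.\<close>

lemma measure_orthogonal_image_compact:
  fixes f :: "'a::euclidean_space \<Rightarrow> 'a"
  assumes f: "orthogonal_transformation f" and "compact S"
  shows "measure lebesgue (f ` S) = measure lebesgue S"
proof -
  obtain r where r: "S \<subseteq> ball 0 r"
    using \<open>compact S\<close> compact_imp_bounded bounded_subset_ballD by blast
  have lin: "linear f" and inj: "inj f"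
    using f orthogonal_transformation_linear orthogonal_transformation_inj by blast+
  have fball: "f ` ball 0 r = ball 0 r"
    using lin by (simp add: image_orthogonal_transformation_ball[OF f] linear_0)
  have fS: "compact (f ` S)"
    using lin \<open>compact S\<close> by (intro compact_continuous_image linear_continuous_on)
      (simp_all add: linear_conv_bounded_linear)
  have "measure lebesgue (ball 0 r - f ` S) = measure lebesgue (f ` (ball 0 r - S))"
    by (simp add: image_set_diff[OF inj] fball)
  also have "\<dots> = measure lebesgue (ball 0 r - S)"
    using emeasure_orthogonal_image_open[OF f, of "ball 0 r - S"] \<open>compact S\<close>
    by (simp add: measure_def compact_imp_closed open_Diff)
  finally have "measure lebesgue (ball 0 r - f ` S) = measure lebesgue (ball 0 r - S)" .
  moreover have "f ` S \<subseteq> ball 0 r" using r fball by blast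
  ultimately show ?thesis
    using r \<open>compact S\<close> fS
    by (simp add: measurable_measure_Diff fmeasurableD lmeasurable_compact)
qed

text \<open>In the singular value decomposition the right orthogonal factor maps the ball onto
  itself, the diagonal factor is a coordinate stretch, and the left orthogonal factor preserves the
  measure of the resulting compact set.\<close>

lemma measure_matrix_image_cball:
  fixes A :: "real^'n^'n"
  shows "measure lebesgue ((*v) A ` cball 0 1) = \<bar>det A\<bar> * measure lebesgue (cball (0 :: real^'n) 1)"
proof -
  obtain U V where U: "orthogonal_matrix U" and V: "orthogonal_matrix V"
    and off: "\<And>i j. i \<noteq> j \<Longrightarrow> (U ** A ** V) $ i $ j = 0"
    by (rule singular_value_decomposition[of A]) blast
  define M where "M = U ** A ** V"
  have VV: "V ** transpose V = mat 1" using V by (simp add: orthogonal_matrix_def)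
  have orth: "orthogonal_transformation ((*v) Q)" if "orthogonal_matrix Q" for Q :: "real^'n^'n"
    using that by (simp add: orthogonal_transformation_matrix)
  have "transpose U ** M ** transpose V = (transpose U ** U) ** A ** (V ** transpose V)"
    by (simp add: M_def matrix_mul_assoc)
  then have A: "A = transpose U ** M ** transpose V"
    using U VV by (simp add: orthogonal_matrix)
  have "(*v) A ` cball 0 1 = (*v) (transpose U) ` (*v) M ` (*v) (transpose V) ` cball 0 1"
    by (subst A) (simp only: image_image matrix_vector_mul_assoc matrix_mul_assoc)
  also have "(*v) (transpose V) ` cball 0 1 = cball (0 :: real^'n) 1"
    using V by (subst image_orthogonal_transformation_cball) (auto intro!: orth)
  finally have "measure lebesgue ((*v) A ` cball 0 1) = measure lebesgue ((*v) M ` cball 0 1)"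
    using U by (simp add: measure_orthogonal_image_compact orth compact_continuous_image
        matrix_vector_mult_linear_continuous_on del: transpose_matrix_vector)
  also have "M *v x = (\<chi> k. M $ k $ k * x $ k)" for x
  proof -
    have "(\<Sum>j\<in>UNIV. M $ k $ j * x $ j) = M $ k $ k * x $ k" for k
      using off by (subst sum.remove[of _ k]) (auto simp: M_def intro!: sum.neutral)
    then show ?thesis by (simp add: matrix_vector_mult_def)
  qed
  then have "(*v) M = (\<lambda>x. \<chi> k. M $ k $ k * x $ k)" by blast
  also have "measure lebesgue ((\<lambda>x. \<chi> k. M $ k $ k * x $ k) ` cball 0 1)
      = \<bar>\<Prod>k\<in>UNIV. M $ k $ k\<bar> * measure lebesgue (cball (0 :: real^'n) 1)"
    by (rule measure_stretch) simp
  also have "(\<Prod>k\<in>UNIV. M $ k $ k) = det M"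
    using off by (subst det_diagonal) (auto simp: M_def)
  also have "\<bar>det M\<bar> = \<bar>det A\<bar>"
    using det_orthogonal_matrix[OF U] det_orthogonal_matrix[OF V] by (auto simp: M_def det_mul abs_mult)
  finally show ?thesis .
qed

section \<open>The dual cone measure\<close>

text \<open>The supremum in \<open>radial_fun\<close> is meaningful only for a set that is bounded
  above; compactness of \<open>K\<close> provides the bound.\<close>

lemma bdd_above_radial:
  fixes K :: "(real^'n) set"
  assumes "compact K" "x \<noteq> 0"
  shows "bdd_above {l. 0 \<le> l \<and> l *\<^sub>R x \<in> K}"
proof -
  obtain b where b: "\<And>y. y \<in> K \<Longrightarrow> norm y \<le> b"
    using assms(1) compact_imp_bounded bounded_iff by metis
  show ?thesis
  proof (rule bdd_aboveI[of _ "b / norm x"])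
    fix l assume "l \<in> {l. 0 \<le> l \<and> l *\<^sub>R x \<in> K}"
    then have "norm (l *\<^sub>R x) \<le> b" "0 \<le> l" using b by blast+
    then show "l \<le> b / norm x" using assms(2) by (simp add: pos_le_divide_eq)
  qed
qed

lemma radial_fun_pos:
  assumes "K \<in> star_bodies" "x \<noteq> 0"
  shows "radial_fun K x > 0"
proof -
  have "0 \<in> interior K" "compact K" using assms(1) by (auto simp: star_bodies_def)
  then obtain e where e: "e > 0" "ball 0 e \<subseteq> K"
    by (meson mem_interior)
  have "norm ((e / (2 * norm x)) *\<^sub>R x) < e" using e assms(2) by simp
  then have "(e / (2 * norm x)) *\<^sub>R x \<in> K" using e by auto
  then have "e / (2 * norm x) \<le> radial_fun K x"
    unfolding radial_fun_def using e bdd_above_radial[OF \<open>compact K\<close> assms(2)]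
    by (intro cSup_upper) auto
  moreover have "e / (2 * norm x) > 0" using e assms(2) by simp
  ultimately show ?thesis by linarith
qed

lemma star_bodies_vol_pos:
  assumes "K \<in> star_bodies"
  shows "vol K > 0"
proof -
  have "0 \<in> interior K" "compact K" using assms by (auto simp: star_bodies_def)
  then obtain e where e: "e > 0" "ball 0 e \<subseteq> K"
    by (meson mem_interior)
  have "0 < vol (ball (0 :: real^'a) e)" using e by (simp add: content_ball_pos)
  also have "\<dots> \<le> vol K"
    using e \<open>compact K\<close> by (intro measure_mono_fmeasurable) (auto intro: lmeasurable_compact)
  finally show ?thesis .
qed

section \<open>Spherical Lebesgue measure\<close>

lemma measurable_sgn_sphere:
  "sgn \<in> measurable (restrict_space lborel (ball 0 1 - {0 :: real^'n})) (restrict_space borel (sphere 0 1))"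
proof (rule measurable_restrict_space2)
  show "sgn \<in> space (restrict_space lborel (ball 0 1 - {0 :: real^'n})) \<rightarrow> sphere 0 1"
    by (auto simp: space_restrict_space norm_sgn)
  show "sgn \<in> borel_measurable (restrict_space lborel (ball 0 1 - {0 :: real^'n}))"
    by (intro measurable_restrict_space1) simp
qed

lemma sets_spherical_measure [measurable_cong]:
  "sets (spherical_measure :: (real^'n) measure) = sets (restrict_space borel (sphere 0 1))"
  by (simp add: spherical_measure_def)

lemma space_spherical_measure:
  "space (spherical_measure :: (real^'n) measure) = sphere 0 1"
  by (simp add: spherical_measure_def space_scale_measure space_restrict_space)

lemma finite_spherical_measure: "finite_measure (spherical_measure :: (real^'n) measure)"
proof (rule finite_measureI)
  have "emeasure (distr (restrict_space lborel (ball 0 1 - {0 :: real^'n})) (restrict_space borel (sphere 0 1)) sgn) (sphere 0 1)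
     \<le> emeasure lborel (ball (0 :: real^'n) 1)"
    by (subst emeasure_distr[OF measurable_sgn_sphere])
      (auto simp: sets_restrict_space emeasure_restrict_space space_restrict_space
        intro!: emeasure_mono)
  also have "\<dots> < \<infinity>"
    by (intro emeasure_bounded_finite) auto
  finally show "emeasure (spherical_measure :: (real^'n) measure) (space spherical_measure) \<noteq> \<infinity>"
    unfolding space_spherical_measure
    by (simp add: spherical_measure_def ennreal_mult_eq_top_iff)
qed

text \<open>Pulled back along \<open>sgn\<close>, the hypothesis says that the points of the
  punctured ball outside the kernel of \<open>T\<close> form a null set. That set is open, hence
  empty, and homogeneity extends \<open>T *v x = 0\<close> to all \<open>x\<close>. This is what
  makes the integral functional strictly positive away from \<open>0\<close>.\<close>

lemma AE_spherical_measure_kernel: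
  fixes T :: "real^'n^'n"
  assumes "AE u in spherical_measure. T *v u = 0"
  shows "T = 0"
proof -
  let ?S = "sphere (0 :: real^'n) 1" and ?B = "ball 0 1 - {0 :: real^'n}"
  let ?D = "distr (restrict_space lborel ?B) (restrict_space borel ?S) sgn"
  let ?Z = "{u \<in> ?S. T *v u \<noteq> 0}"
  have cl: "closed {u. T *v u = 0}"
    by (intro closed_Collect_eq continuous_intros)
  have ms: "(\<lambda>u. T *v u) \<in> borel_measurable (restrict_space borel ?S)"
    by (intro measurable_restrict_space1 borel_measurable_continuous_onI continuous_intros)
  have op: "open {x. x \<in> ?B \<and> T *v x \<noteq> 0}"
  proof -
    have "{x. x \<in> ?B \<and> T *v x \<noteq> 0} = ?B - {u. T *v u = 0}" by auto
    then show ?thesis using cl by (simp add: open_Diff open_delete)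
  qed
  have Zs: "{u \<in> space (restrict_space borel ?S). T *v u = 0} \<in> sets (restrict_space borel ?S)"
    using ms by measurable
  have Zs': "?Z \<in> sets (restrict_space borel ?S)"
    using sets.compl_sets[OF Zs] by (simp add: space_restrict_space set_diff_eq conj_commute cong: conj_cong)
  have "emeasure spherical_measure ?Z = 0"
    using assms Zs' by (subst (asm) AE_iff_measurable[of ?Z])
      (auto simp: sets_spherical_measure space_spherical_measure)
  then have "emeasure ?D ?Z = 0"
    by (simp add: spherical_measure_def)
  then have "AE u in ?D. T *v u = 0"
    using Zs' by (subst AE_iff_measurable[of ?Z]) (auto simp: space_restrict_space)
  then have "AE x in restrict_space lborel ?B. T *v (sgn x) = 0"
    using Zs by (subst (asm) AE_distr_iff[OF measurable_sgn_sphere]) auto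
  then have "AE x in lborel. x \<in> ?B \<longrightarrow> T *v (sgn x) = 0"
    by (subst (asm) AE_restrict_space_iff) auto
  then have "AE x in lborel. x \<in> ?B \<longrightarrow> T *v x = 0"
    by eventually_elim (auto simp: sgn_div_norm matrix_vector_mult_scaleR)
  then have "emeasure lborel {x. x \<in> ?B \<and> T *v x \<noteq> 0} = 0"
    using op by (subst (asm) AE_iff_measurable[of "{x. x \<in> ?B \<and> T *v x \<noteq> 0}"]) auto
  then have "{x. x \<in> ?B \<and> T *v x \<noteq> 0} = {}"
    using op open_not_negligible negligible_iff_null_sets null_sets_completionI
    by (metis (no_types, lifting) borel_open null_setsI sets_lborel)
  then have small: "T *v x = 0" if "norm x < 1" for x
    using that by (cases "x = 0") auto
  have "T *v x = 0" for x
  proof -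
    have "norm x + 1 > 0" using norm_ge_zero[of x] by linarith
    then show ?thesis
      using small[of "(1 / (norm x + 1)) *\<^sub>R x"]
      by (simp add: matrix_vector_mult_scaleR)
  qed
  then show "T = 0" by (simp add: matrix_eq)
qed

section \<open>The dual cone measure of a star body\<close>

context
  fixes K :: "(real^'n) set"
  assumes K: "K \<in> star_bodies"
begin

lemma sets_dual_cone_measure [measurable_cong]:
  "sets (dual_cone_measure K) = sets (restrict_space borel (sphere 0 1))"
  by (simp add: dual_cone_measure_def sets_spherical_measure)

lemma space_dual_cone_measure: "space (dual_cone_measure K) = sphere 0 1"
  by (simp add: dual_cone_measure_def space_spherical_measure)

lemma continuous_on_radial_fun: "continuous_on (sphere 0 1) (radial_fun K)"
  using K by (simp add: star_bodies_def)

lemma measurable_dual_cone_density: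
  "(\<lambda>u. ennreal (radial_fun K u ^ CARD('n) / (real CARD('n) * vol K)))
    \<in> borel_measurable (spherical_measure :: (real^'n) measure)"
proof -
  have "(\<lambda>u. radial_fun K u ^ CARD('n) / (real CARD('n) * vol K))
      \<in> borel_measurable (restrict_space borel (sphere 0 1))"
    using continuous_on_radial_fun star_bodies_vol_pos[OF K]
    by (intro borel_measurable_continuous_on_restrict continuous_intros) auto
  then show ?thesis
    by (simp cong: measurable_cong_sets[OF sets_spherical_measure refl])
qed

text \<open>The density is continuous on the compact sphere, hence bounded, and spherical measure is
  finite.\<close>

lemma finite_dual_cone_measure: "finite_measure (dual_cone_measure K)"
proof (rule finite_measureI)
  let ?d = "\<lambda>u. radial_fun K u ^ CARD('n) / (real CARD('n) * vol K)"
  have "continuous_on (sphere 0 1) ?d"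
    using continuous_on_radial_fun star_bodies_vol_pos[OF K]
    by (intro continuous_intros) auto
  then have "compact (?d ` sphere 0 1)"
    by (intro compact_continuous_image) auto
  then obtain b where "\<forall>y\<in>?d ` sphere 0 1. norm y \<le> b"
    using compact_imp_bounded bounded_iff by blast
  then have b: "norm (?d u) \<le> b" if "u \<in> sphere 0 1" for u
    using that by blast
  have "emeasure (dual_cone_measure K) (space (dual_cone_measure K))
      = (\<integral>\<^sup>+u. ennreal (?d u) \<partial>spherical_measure)"
    unfolding dual_cone_measure_def
    by (subst emeasure_density[OF measurable_dual_cone_density])
      (auto intro!: nn_integral_cong)
  also have "\<dots> \<le> (\<integral>\<^sup>+u. ennreal b \<partial>(spherical_measure :: (real^'n) measure))"
    using b by (intro nn_integral_mono ennreal_leI)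
      (metis abs_le_D1 real_norm_def space_spherical_measure)
  also have "\<dots> < \<infinity>"
    using finite_measure.emeasure_finite[OF finite_spherical_measure[where 'n = 'n]]
    by (simp add: ennreal_mult_eq_top_iff less_top[symmetric])
  finally show "emeasure (dual_cone_measure K) (space (dual_cone_measure K)) \<noteq> \<infinity>" by simp
qed

lemma integrable_dual_cone_measure:
  fixes f :: "real^'n \<Rightarrow> real"
  assumes "continuous_on (sphere 0 1) f"
  shows "integrable (dual_cone_measure K) f"
proof -
  have "compact (f ` sphere 0 1)"
    using assms by (intro compact_continuous_image) auto
  then obtain b where "\<forall>y\<in>f ` sphere 0 1. norm y \<le> b"
    using compact_imp_bounded bounded_iff by blast
  then have b: "norm (f u) \<le> b" if "u \<in> sphere 0 1" for u
    using that by blast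
  have "f \<in> borel_measurable (dual_cone_measure K)"
    using borel_measurable_continuous_on_restrict[OF assms]
    by (simp cong: measurable_cong_sets[OF sets_dual_cone_measure refl])
  then show ?thesis
    using b finite_measure.integrable_const_bound[OF finite_dual_cone_measure]
    by (metis (mono_tags, lifting) AE_I2 space_dual_cone_measure)
qed

text \<open>The density is strictly positive on the sphere, so a property valid almost everywhere
  for the dual cone measure is valid almost everywhere for spherical measure.\<close>

lemma AE_dual_cone_measure_kernel:
  fixes T :: "real^'n^'n"
  assumes "AE u in dual_cone_measure K. T *v u = 0"
  shows "T = 0"
proof (rule AE_spherical_measure_kernel)
  have "AE u in spherical_measure. 0 < ennreal (radial_fun K u ^ CARD('n) / (real CARD('n) * vol K)) \<longrightarrow> T *v u = 0"
    using assms unfolding dual_cone_measure_def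
    by (subst (asm) AE_density[OF measurable_dual_cone_density])
  moreover have "AE u in spherical_measure. 0 < ennreal (radial_fun K u ^ CARD('n) / (real CARD('n) * vol K))"
  proof (rule AE_I2)
    fix u :: "real^'n" assume "u \<in> space spherical_measure"
    then have "u \<noteq> 0" by (auto simp: space_spherical_measure)
    then show "0 < ennreal (radial_fun K u ^ CARD('n) / (real CARD('n) * vol K))"
      using radial_fun_pos[OF K] star_bodies_vol_pos[OF K] by simp
  qed
  ultimately show "AE u in spherical_measure. T *v u = 0"
    by eventually_elim auto
qed

end

section \<open>Convex functions and ellipsoids\<close>

context
  fixes \<phi> :: "real \<Rightarrow> real"
  assumes \<phi>: "\<phi> \<in> Phi_class"
begin

lemma Phi_zero: "\<phi> 0 = 0"
  using \<phi> by (simp add: Phi_class_def)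

lemma Phi_less: "0 \<le> x \<Longrightarrow> x < y \<Longrightarrow> \<phi> x < \<phi> y"
  using \<phi> by (auto simp: Phi_class_def strict_mono_on_def)

lemma Phi_mono: "0 \<le> x \<Longrightarrow> x \<le> y \<Longrightarrow> \<phi> x \<le> \<phi> y"
  using Phi_less[of x y] by (cases "x = y") auto

lemma Phi_pos: "0 < x \<Longrightarrow> 0 < \<phi> x"
  using Phi_less[of 0 x] by (simp add: Phi_zero)

lemma Phi_nonneg: "0 \<le> x \<Longrightarrow> 0 \<le> \<phi> x"
  using Phi_mono[of 0 x] by (simp add: Phi_zero)

lemma Phi_convex:
  "\<lbrakk>0 \<le> x; 0 \<le> y; 0 \<le> s; 0 \<le> t; s + t = 1\<rbrakk> \<Longrightarrow> \<phi> (s * x + t * y) \<le> s * \<phi> x + t * \<phi> y"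
  using \<phi> by (auto simp: Phi_class_def convex_on_def)

text \<open>Convexity on the segment from \<open>0\<close> to \<open>x\<close>, together with
  \<open>\<phi> 0 = 0\<close>. Read backwards, it says that \<phi> grows at least linearly.\<close>

lemma Phi_scale: "\<lbrakk>0 \<le> x; 0 \<le> t; t \<le> 1\<rbrakk> \<Longrightarrow> \<phi> (t * x) \<le> t * \<phi> x"
  using Phi_convex[of x 0 t "1 - t"] by (simp add: Phi_zero)

text \<open>Extending \<open>\<phi>\<close> evenly to the whole line keeps it convex, which also yields continuity at the
  end point \<open>0\<close>.\<close>

lemma Phi_continuous_on: "continuous_on {0..} \<phi>"
proof -
  have "convex_on UNIV (\<lambda>x. \<phi> \<bar>x\<bar>)"
    unfolding convex_on_def
  proof (intro conjI ballI allI impI)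
    fix x y u v :: real assume uv: "0 \<le> u" "0 \<le> v" "u + v = 1"
    have "\<bar>u *\<^sub>R x + v *\<^sub>R y\<bar> \<le> u * \<bar>x\<bar> + v * \<bar>y\<bar>"
      using uv abs_triangle_ineq[of "u * x" "v * y"] by (simp add: abs_mult)
    then have "\<phi> \<bar>u *\<^sub>R x + v *\<^sub>R y\<bar> \<le> \<phi> (u * \<bar>x\<bar> + v * \<bar>y\<bar>)"
      by (intro Phi_mono) auto
    also have "\<dots> \<le> u * \<phi> \<bar>x\<bar> + v * \<phi> \<bar>y\<bar>"
      using uv by (intro Phi_convex) auto
    finally show "\<phi> \<bar>u *\<^sub>R x + v *\<^sub>R y\<bar> \<le> u * \<phi> \<bar>x\<bar> + v * \<phi> \<bar>y\<bar>" .
  qed auto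
  then have "continuous_on UNIV (\<lambda>x. \<phi> \<bar>x\<bar>)"
    by (rule convex_on_continuous[OF open_UNIV])
  then have "continuous_on {0..} (\<lambda>x. \<phi> \<bar>x\<bar>)"
    by (rule continuous_on_subset) auto
  then show ?thesis
    by (rule continuous_on_eq) auto
qed

text \<open>A value of \<open>inv_into\<close> is meaningful only on the range of \<phi>, so the
  proof first produces a preimage of \<open>y\<close> by the intermediate value theorem and then
  uses monotonicity.\<close>

lemma inv_into_Phi_le_one_iff:
  assumes "0 \<le> y"
  shows "inv_into {0..} \<phi> y \<le> 1 \<longleftrightarrow> y \<le> \<phi> 1"
proof -
  have p1: "\<phi> 1 > 0" by (simp add: Phi_pos)
  \<comment> \<open>With \<open>s \<ge> 1\<close>, at least linear growth gives
    \<open>\<phi> s \<ge> s * \<phi> 1\<close>, and the second argument of the maximum makes this at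
    least \<open>y\<close>.\<close>
  define s where "s = max 1 (y / \<phi> 1)"
  have s: "s \<ge> 1" by (simp add: s_def)
  have "y \<le> s * \<phi> 1"
    using p1 by (simp add: s_def pos_divide_le_eq[symmetric])
  also have "\<phi> 1 \<le> (1 / s) * \<phi> s"
    using Phi_scale[of s "1 / s"] s by simp
  then have "s * \<phi> 1 \<le> \<phi> s" using s by (simp add: field_simps)
  finally obtain x where x: "x \<ge> 0" "\<phi> x = y"
    using IVT'[of \<phi> 0 y s] assms s Phi_continuous_on
    using continuous_on_subset[OF Phi_continuous_on, of "{0..s}"] by (auto simp: Phi_zero)
  have "inj_on \<phi> {0..}"
    using \<phi> by (auto simp: Phi_class_def intro: strict_mono_on_imp_inj_on)
  then have "inv_into {0..} \<phi> y = x"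
    using x by (auto intro: inv_into_f_eq)
  moreover have "x \<le> 1 \<longleftrightarrow> \<phi> x \<le> \<phi> 1"
    using Phi_mono[of x 1] Phi_less[of 1 x] x(1) by fastforce
  ultimately show ?thesis using x by simp
qed

end

section \<open>Ellipsoids described by matrices\<close>

definition ellipsoid_of :: "real^'n^'n \<Rightarrow> (real^'n) set" where
  "ellipsoid_of T = {x. norm (T *v x) \<le> 1}"

lemma image_cball_eq_ellipsoid_of:
  fixes A T :: "real^'n^'n"
  assumes "A ** T = mat 1" "T ** A = mat 1"
  shows "(*v) A ` cball 0 1 = ellipsoid_of T"
proof (intro equalityI subsetI)
  fix x assume "x \<in> ellipsoid_of T"
  then have "T *v x \<in> cball 0 1" "x = A *v (T *v x)"
    using assms by (auto simp: ellipsoid_of_def matrix_vector_mul_assoc)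
  then show "x \<in> (*v) A ` cball 0 1" by (rule rev_image_eqI)
qed (use assms in \<open>auto simp: ellipsoid_of_def matrix_vector_mul_assoc\<close>)

lemma ellipsoids_iff:
  fixes E :: "(real^'n) set"
  shows "E \<in> ellipsoids \<longleftrightarrow> (\<exists>T :: real^'n^'n. invertible T \<and> E = ellipsoid_of T)"
proof -
  have *: "invertible M \<longleftrightarrow> (\<exists>N. M ** N = mat 1 \<and> N ** M = mat 1)" for M :: "real^'n^'n"
    by (simp add: invertible_def)
  show ?thesis
    unfolding ellipsoids_def mem_Collect_eq *
    using image_cball_eq_ellipsoid_of by (metis (no_types, lifting))
qed

lemma scaleR_image_ellipsoid_of:
  assumes "c > 0"
  shows "(\<lambda>x. c *\<^sub>R x) ` ellipsoid_of T = ellipsoid_of ((1 / c) *\<^sub>R T)"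
proof (intro equalityI subsetI)
  fix x assume "x \<in> ellipsoid_of ((1 / c) *\<^sub>R T)"
  then have "(1 / c) *\<^sub>R x \<in> ellipsoid_of T" "x = c *\<^sub>R ((1 / c) *\<^sub>R x)"
    using assms
    by (auto simp: ellipsoid_of_def matrix_vector_mult_scaleR simp flip: scaleR_matrix_vector_assoc)
  then show "x \<in> (\<lambda>x. c *\<^sub>R x) ` ellipsoid_of T" by (rule rev_image_eqI)
qed (use assms in \<open>auto simp: ellipsoid_of_def matrix_vector_mult_scaleR
  simp flip: scaleR_matrix_vector_assoc\<close>)

lemma invertible_mult_nonzero:
  fixes T :: "real^'n^'n"
  assumes "invertible T" "x \<noteq> 0"
  shows "T *v x \<noteq> 0"
  using assms by (metis invertible_left_inverse matrix_left_invertible_ker)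

text \<open>This is the reason for describing an ellipsoid by the inverse \<open>T\<close> of the
  matrix that maps the ball onto it: the reciprocal radial function is a norm of
  \<open>T *v x\<close>, hence convex in \<open>T\<close>.\<close>

lemma radial_fun_ellipsoid_of:
  fixes T :: "real^'n^'n"
  assumes "invertible T" "x \<noteq> 0"
  shows "radial_fun (ellipsoid_of T) x = 1 / norm (T *v x)"
proof -
  have "norm (T *v x) > 0" using invertible_mult_nonzero[OF assms] by simp
  then have "{l. 0 \<le> l \<and> l *\<^sub>R x \<in> ellipsoid_of T} = {0..1 / norm (T *v x)}"
    by (auto simp: ellipsoid_of_def matrix_vector_mult_scaleR field_simps)
  then show ?thesis by (simp add: radial_fun_def)
qed

lemma unit_ball_vol_pos: "unit_ball_vol TYPE('n::finite) > 0"
  unfolding unit_ball_vol_def by (simp add: content_cball_pos)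

lemma vol_ellipsoid_of:
  fixes T :: "real^'n^'n"
  assumes "invertible T"
  shows "vol (ellipsoid_of T) = unit_ball_vol TYPE('n) / \<bar>det T\<bar>"
proof -
  obtain A where A: "A ** T = mat 1" "T ** A = mat 1"
    using assms by (auto simp: invertible_def)
  have "det A * det T = 1" using A(1) by (metis det_I det_mul)
  then have "\<bar>det A\<bar> * \<bar>det T\<bar> = 1" by (metis abs_mult abs_one)
  then have "\<bar>det A\<bar> = 1 / \<bar>det T\<bar>"
    by (metis mult_zero_right nonzero_eq_divide_eq zero_neq_one)
  moreover have "vol ((*v) A ` cball 0 1) = \<bar>det A\<bar> * unit_ball_vol TYPE('n)"
    unfolding unit_ball_vol_def by (rule measure_matrix_image_cball)
  ultimately show ?thesis by (simp add: image_cball_eq_ellipsoid_of[OF A])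
qed

lemma vol_ratio_ellipsoid_of:
  fixes T :: "real^'n^'n"
  assumes "invertible T"
  shows "vol_ratio (ellipsoid_of T) = root CARD('n) \<bar>det T\<bar>"
  using unit_ball_vol_pos[where 'n = 'n] by (simp add: vol_ratio_def vol_ellipsoid_of[OF assms])

lemma invertible_scaleR:
  fixes T :: "real^'n^'n"
  assumes "invertible T" "c \<noteq> 0"
  shows "invertible (c *\<^sub>R T)"
proof -
  obtain A where "A ** T = mat 1" "T ** A = mat 1"
    using assms by (auto simp: invertible_def)
  then have "(c *\<^sub>R T) ** ((1 / c) *\<^sub>R A) = mat 1" "((1 / c) *\<^sub>R A) ** (c *\<^sub>R T) = mat 1"
    using assms(2) by (simp_all add: matrix_scalar_ac flip: scalar_matrix_assoc)
  then show ?thesis unfolding invertible_def by blast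
qed

lemma det_scaleR:
  fixes T :: "real^'n^'n"
  shows "det (c *\<^sub>R T) = c ^ CARD('n) * det T"
proof -
  have "c *\<^sub>R T = mat c ** T"
    by (simp add: vec_eq_iff matrix_matrix_mult_def mat_def if_distrib[of "\<lambda>x. x * _"] cong: if_cong)
  moreover have "det (mat c :: real^'n^'n) = c ^ CARD('n)"
    by (subst det_diagonal) (auto simp: mat_def)
  ultimately show ?thesis by (simp add: det_mul)
qed

text \<open>The root in \<open>vol_ratio\<close> makes it homogeneous of degree -1 under dilation,
  the same degree as \<open>orlicz_functional\<close>.\<close>

lemma ellipsoids_scaleR_image:
  fixes E :: "(real^'n) set"
  assumes "E \<in> ellipsoids" "c > 0"
  shows "(\<lambda>x. c *\<^sub>R x) ` E \<in> ellipsoids"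
    and "vol_ratio ((\<lambda>x. c *\<^sub>R x) ` E) = vol_ratio E / c"
proof -
  obtain T :: "real^'n^'n" where T: "invertible T" "E = ellipsoid_of T"
    using assms(1) ellipsoids_iff by blast
  have inv: "invertible ((1 / c) *\<^sub>R T)"
    using invertible_scaleR[OF T(1)] assms(2) by simp
  show "(\<lambda>x. c *\<^sub>R x) ` E \<in> ellipsoids"
    using inv T(2) scaleR_image_ellipsoid_of[OF assms(2), of T] ellipsoids_iff by blast
  show "vol_ratio ((\<lambda>x. c *\<^sub>R x) ` E) = vol_ratio E / c"
    unfolding T(2) scaleR_image_ellipsoid_of[OF assms(2)] vol_ratio_ellipsoid_of[OF inv]
      vol_ratio_ellipsoid_of[OF T(1)] det_scaleR
    using assms(2) by (simp add: abs_mult real_root_mult power_divide real_root_divide real_root_power_cancel)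
qed

lemma vol_ratio_pos: "E \<in> ellipsoids \<Longrightarrow> vol_ratio E > 0"
  for E :: "(real^'n) set"
  by (auto simp: ellipsoids_iff vol_ratio_ellipsoid_of invertible_det_nz)

text \<open>Rewrites the volume constraint of one problem in terms of the objective of the
  other.\<close>

lemma vol_le_unit_ball_vol_iff:
  fixes E :: "(real^'n) set"
  assumes "E \<in> ellipsoids"
  shows "vol E \<le> unit_ball_vol TYPE('n) \<longleftrightarrow> vol_ratio E \<ge> 1"
proof -
  obtain T :: "real^'n^'n" where T: "invertible T" "E = ellipsoid_of T"
    using assms ellipsoids_iff by blast
  have "\<bar>det T\<bar> > 0" using T(1) by (simp add: invertible_det_nz)
  then show ?thesis
    using unit_ball_vol_pos[where 'n = 'n]
    by (simp add: T(2) vol_ellipsoid_of[OF T(1)] vol_ratio_ellipsoid_of[OF T(1)] divide_le_eq)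
qed

section \<open>The extremal problems\<close>

locale orlicz_body =
  fixes K :: "(real^'n) set" and \<phi> :: "real \<Rightarrow> real"
  assumes K: "K \<in> star_bodies" and \<phi>: "\<phi> \<in> Phi_class"
begin

text \<open>The function \<open>G\<close> of the outline. It is defined for every matrix, singular
  ones included, so that convexity and continuity can be used on the whole vector space; a factor
  \<open>l\<close> in the functional is absorbed into \<open>T\<close>.\<close>

definition orlicz_integral :: "real^'n^'n \<Rightarrow> real" where
  "orlicz_integral T = (\<integral>u. \<phi> (radial_fun K u * norm (T *v u)) \<partial>dual_cone_measure K)"

lemma radial_nonneg: "u \<in> sphere 0 1 \<Longrightarrow> 0 \<le> radial_fun K u"
  using radial_fun_pos[OF K, of u] by fastforce

lemma integrable_orlicz:
  "integrable (dual_cone_measure K) (\<lambda>u. \<phi> (radial_fun K u * norm (T *v u)))"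
proof (rule integrable_dual_cone_measure[OF K])
  have "continuous_on (sphere 0 1) (\<lambda>u. radial_fun K u * norm (T *v u))"
    by (intro continuous_intros continuous_on_radial_fun[OF K])
  then show "continuous_on (sphere 0 1) (\<lambda>u. \<phi> (radial_fun K u * norm (T *v u)))"
    by (rule continuous_on_compose2[OF Phi_continuous_on[OF \<phi>]]) (use radial_nonneg in auto)
qed

lemma orlicz_integral_nonneg: "0 \<le> orlicz_integral T"
  unfolding orlicz_integral_def
  by (rule Bochner_Integration.integral_nonneg_AE, rule AE_I2)
    (auto intro!: Phi_nonneg[OF \<phi>] mult_nonneg_nonneg radial_nonneg simp: space_dual_cone_measure[OF K])

text \<open>The inequality holds pointwise under the integral: triangle inequality for the norm,
  then monotonicity and convexity of \<phi>.\<close>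

lemma orlicz_integral_convex:
  assumes "0 \<le> s" "0 \<le> t" "s + t = 1"
  shows "orlicz_integral (s *\<^sub>R A + t *\<^sub>R B) \<le> s * orlicz_integral A + t * orlicz_integral B"
proof -
  let ?\<rho> = "radial_fun K"
  have "orlicz_integral (s *\<^sub>R A + t *\<^sub>R B)
      \<le> (\<integral>u. s * \<phi> (?\<rho> u * norm (A *v u)) + t * \<phi> (?\<rho> u * norm (B *v u)) \<partial>dual_cone_measure K)"
    unfolding orlicz_integral_def
  proof (intro integral_mono Bochner_Integration.integrable_add integrable_mult_right integrable_orlicz)
    fix u assume "u \<in> space (dual_cone_measure K)"
    then have \<rho>: "0 \<le> ?\<rho> u" by (intro radial_nonneg) (simp add: space_dual_cone_measure[OF K])
    have "norm ((s *\<^sub>R A + t *\<^sub>R B) *v u) \<le> s * norm (A *v u) + t * norm (B *v u)"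
      using norm_triangle_ineq[of "s *\<^sub>R (A *v u)" "t *\<^sub>R (B *v u)"] assms
      by (simp add: matrix_vector_mult_add_rdistrib flip: scaleR_matrix_vector_assoc)
    then have "?\<rho> u * norm ((s *\<^sub>R A + t *\<^sub>R B) *v u)
        \<le> s * (?\<rho> u * norm (A *v u)) + t * (?\<rho> u * norm (B *v u))"
      using mult_left_mono[OF _ \<rho>] by (fastforce simp: algebra_simps)
    then have "\<phi> (?\<rho> u * norm ((s *\<^sub>R A + t *\<^sub>R B) *v u))
        \<le> \<phi> (s * (?\<rho> u * norm (A *v u)) + t * (?\<rho> u * norm (B *v u)))"
      using \<rho> by (intro Phi_mono[OF \<phi>]) auto
    also have "\<dots> \<le> s * \<phi> (?\<rho> u * norm (A *v u)) + t * \<phi> (?\<rho> u * norm (B *v u))"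
      using \<rho> assms by (intro Phi_convex[OF \<phi>]) auto
    finally show "\<phi> (?\<rho> u * norm ((s *\<^sub>R A + t *\<^sub>R B) *v u))
        \<le> s * \<phi> (?\<rho> u * norm (A *v u)) + t * \<phi> (?\<rho> u * norm (B *v u))" .
  qed
  also have "\<dots> = s * orlicz_integral A + t * orlicz_integral B"
    unfolding orlicz_integral_def by (simp add: integrable_orlicz)
  finally show ?thesis .
qed

lemma orlicz_integral_zero: "orlicz_integral 0 = 0"
  by (simp add: orlicz_integral_def Phi_zero[OF \<phi>])

lemma orlicz_integral_scale:
  assumes "0 \<le> t" "t \<le> 1"
  shows "orlicz_integral (t *\<^sub>R A) \<le> t * orlicz_integral A"
  using orlicz_integral_convex[of t "1 - t" A 0] assms by (simp add: orlicz_integral_zero)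

lemma continuous_on_orlicz_integral: "continuous_on S orlicz_integral"
proof -
  have "convex_on UNIV orlicz_integral"
    by (auto simp: convex_on_def intro: orlicz_integral_convex)
  then have "continuous_on UNIV orlicz_integral"
    by (rule convex_on_continuous[OF open_UNIV])
  then show ?thesis by (rule continuous_on_subset) simp
qed

text \<open>If the integral of the nonnegative integrand vanishes, so does the integrand almost
  everywhere. As the radial function is positive and \<phi> vanishes only at \<open>0\<close>, this
  forces \<open>T *v u = 0\<close> almost everywhere.\<close>

lemma orlicz_integral_pos:
  assumes "T \<noteq> 0"
  shows "0 < orlicz_integral T"
proof (rule ccontr)
  let ?f = "\<lambda>u. \<phi> (radial_fun K u * norm (T *v u))"
  have nonneg: "AE u in dual_cone_measure K. 0 \<le> ?f u"
    by (rule AE_I2) (auto intro!: Phi_nonneg[OF \<phi>] mult_nonneg_nonneg radial_nonneg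
      simp: space_dual_cone_measure[OF K])
  assume "\<not> 0 < orlicz_integral T"
  then have "orlicz_integral T = 0" using orlicz_integral_nonneg[of T] by simp
  then have "AE u in dual_cone_measure K. ?f u = 0"
    using integral_nonneg_eq_0_iff_AE[OF integrable_orlicz nonneg] by (simp add: orlicz_integral_def)
  moreover have "AE u in dual_cone_measure K. u \<in> sphere 0 1"
    by (rule AE_I2) (simp add: space_dual_cone_measure[OF K])
  ultimately have "AE u in dual_cone_measure K. T *v u = 0"
  proof eventually_elim
    case (elim u)
    show ?case
    proof (rule ccontr)
      assume "T *v u \<noteq> 0"
      then have "0 < radial_fun K u * norm (T *v u)"
        using radial_fun_pos[OF K, of u] elim(2) by fastforce
      then show False using Phi_pos[OF \<phi>] elim(1) by fastforce
    qed
  qed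
  then show False using AE_dual_cone_measure_kernel[OF K] assms by blast
qed

lemma orlicz_integral_orthogonal:
  "orthogonal_matrix Q \<Longrightarrow> orlicz_integral (Q ** T) = orlicz_integral T"
  by (simp add: orlicz_integral_def norm_orthogonal_matrix_mult flip: matrix_vector_mul_assoc)

lemma compact_orlicz_sublevel: "compact {T. orlicz_integral T \<le> \<phi> 1}"
  unfolding compact_eq_bounded_closed
proof
  show "closed {T. orlicz_integral T \<le> \<phi> 1}"
    by (intro closed_Collect_le continuous_on_orlicz_integral continuous_intros)
  have "sphere (0 :: real^'n^'n) 1 \<noteq> {}" by simp
  then obtain T0 :: "real^'n^'n" where T0: "T0 \<in> sphere 0 1"
      "\<And>T. T \<in> sphere 0 1 \<Longrightarrow> orlicz_integral T0 \<le> orlicz_integral T"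
    using continuous_attains_inf[OF compact_sphere _ continuous_on_orlicz_integral] by blast
  \<comment> \<open>The minimum over the unit sphere, attained by compactness and therefore
    positive. It is the rate of linear growth used for the bound below.\<close>
  define m where "m = orlicz_integral T0"
  have m: "m > 0" unfolding m_def using T0(1) by (intro orlicz_integral_pos) auto
  have "norm T \<le> max 1 (\<phi> 1 / m)" if T: "orlicz_integral T \<le> \<phi> 1" for T
  proof (cases "norm T \<le> 1")
    case False
    then have nT: "norm T > 0" by linarith
    \<comment> \<open>Outside the unit ball, convexity along the ray from \<open>0\<close> gives
      \<open>m * norm T \<le> orlicz_integral T\<close>.\<close>
    from False have "m \<le> orlicz_integral ((1 / norm T) *\<^sub>R T)"
      unfolding m_def by (intro T0(2)) auto
    also have "\<dots> \<le> (1 / norm T) * orlicz_integral T"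
      using False by (intro orlicz_integral_scale) (auto simp: divide_simps)
    also have "\<dots> \<le> (1 / norm T) * \<phi> 1"
      using T by (intro mult_left_mono) auto
    finally have "norm T \<le> \<phi> 1 / m"
      using m nT by (simp add: field_simps)
    then show ?thesis by simp
  qed simp
  then show "bounded {T. orlicz_integral T \<le> \<phi> 1}"
    unfolding bounded_iff by blast
qed

section \<open>The functional on ellipsoids\<close>

lemma orlicz_functional_ellipsoid_of:
  assumes "invertible T"
  shows "orlicz_functional \<phi> K (ellipsoid_of T)
    = Inf {l. l > 0 \<and> orlicz_integral ((1 / l) *\<^sub>R T) \<le> \<phi> 1}"
proof -
  have "(inv_into {0..} \<phi> (\<integral>u. \<phi> (radial_fun K u / (l * radial_fun (ellipsoid_of T) u))
      \<partial>dual_cone_measure K) \<le> 1) \<longleftrightarrow> orlicz_integral ((1 / l) *\<^sub>R T) \<le> \<phi> 1" if "l > 0" for l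
  proof -
    have "(\<integral>u. \<phi> (radial_fun K u / (l * radial_fun (ellipsoid_of T) u)) \<partial>dual_cone_measure K)
        = orlicz_integral ((1 / l) *\<^sub>R T)"
      unfolding orlicz_integral_def
    proof (rule Bochner_Integration.integral_cong[OF refl])
      fix u assume "u \<in> space (dual_cone_measure K)"
      then have "u \<noteq> 0" by (auto simp: space_dual_cone_measure[OF K])
      then show "\<phi> (radial_fun K u / (l * radial_fun (ellipsoid_of T) u))
          = \<phi> (radial_fun K u * norm ((1 / l) *\<^sub>R T *v u))"
        using that by (simp add: radial_fun_ellipsoid_of[OF assms] flip: scaleR_matrix_vector_assoc)
    qed
    then show ?thesis
      using inv_into_Phi_le_one_iff[OF \<phi> orlicz_integral_nonneg] by metis
  qed
  then show ?thesis
    unfolding orlicz_functional_def by meson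
qed

text \<open>The set of admissible \<open>l\<close> is nonempty, closed upwards, and closed within
  the positive reals by continuity, so comparing its infimum with a positive \<open>l\<close>
  amounts to membership of \<open>l\<close>.\<close>

lemma orlicz_functional_le_iff:
  assumes T: "invertible T" and l: "l > 0"
  shows "orlicz_functional \<phi> K (ellipsoid_of T) \<le> l \<longleftrightarrow> orlicz_integral ((1 / l) *\<^sub>R T) \<le> \<phi> 1"
proof -
  let ?G = "\<lambda>l. orlicz_integral ((1 / l) *\<^sub>R T)"
  let ?S = "{l. l > 0 \<and> ?G l \<le> \<phi> 1}"
  have \<phi>1: "\<phi> 1 > 0" by (rule Phi_pos[OF \<phi>]) simp
  have bdd: "bdd_below ?S" by (rule bdd_belowI[of _ 0]) auto
  have up: "b \<in> ?S" if "a \<in> ?S" "a \<le> b" for a b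
  proof -
    have ab: "0 < a" "a \<le> b" "?G a \<le> \<phi> 1" using that by auto
    have "(1 / b) *\<^sub>R T = (a / b) *\<^sub>R ((1 / a) *\<^sub>R T)" using ab by simp
    then have "?G b \<le> (a / b) * ?G a"
      using ab orlicz_integral_scale[of "a / b" "(1 / a) *\<^sub>R T"] by simp
    also have "\<dots> \<le> 1 * ?G a"
      using ab orlicz_integral_nonneg by (intro mult_right_mono) auto
    finally show ?thesis using ab by simp
  qed
  \<comment> \<open>An explicit admissible \<open>a\<close>: dividing \<open>T\<close> by it brings
    the integral down to at most \<open>\<phi> 1\<close>. Without a member the infimum would be
    unspecified.\<close>
  define a where "a = max 1 (orlicz_integral T / \<phi> 1)"
  have "?G a \<le> (1 / a) * orlicz_integral T"
    by (rule orlicz_integral_scale) (auto simp: a_def)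
  also have "orlicz_integral T \<le> a * \<phi> 1"
    using \<phi>1 by (simp add: a_def pos_divide_le_eq[symmetric])
  then have "(1 / a) * orlicz_integral T \<le> (1 / a) * (a * \<phi> 1)"
    by (intro mult_left_mono) (auto simp: a_def)
  also have "(1 / a) * (a * \<phi> 1) = \<phi> 1" by (simp add: a_def)
  finally have "a \<in> ?S" by (simp add: a_def)
  then have ne: "?S \<noteq> {}" by blast
  have "Inf ?S \<le> l \<longleftrightarrow> ?G l \<le> \<phi> 1"
  proof
    assume le: "Inf ?S \<le> l"
    \<comment> \<open>The infimum may equal \<open>l\<close> without being known to be attained, so
      \<open>l\<close> is approached from above and continuity passes to the limit.\<close>
    have in_S: "?G (l + 1 / real (Suc k)) \<le> \<phi> 1" for k
    proof -
      have "Inf ?S < l + 1 / real (Suc k)" using le by (rule le_less_trans) simp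
      then obtain b where "b \<in> ?S" "b < l + 1 / real (Suc k)"
        using cInf_lessD[OF ne] by blast
      then show ?thesis using up[of b "l + 1 / real (Suc k)"] by auto
    qed
    have "(\<lambda>k. l + 1 / real (Suc k)) \<longlonglongrightarrow> l + 0"
      by (intro tendsto_intros) (rule LIMSEQ_Suc[OF lim_1_over_n])
    then have "(\<lambda>k. (1 / (l + 1 / real (Suc k))) *\<^sub>R T) \<longlonglongrightarrow> (1 / l) *\<^sub>R T"
      using l by (intro tendsto_intros) auto
    moreover have "isCont orlicz_integral ((1 / l) *\<^sub>R T)"
      using continuous_on_orlicz_integral[of UNIV] by (simp add: continuous_on_eq_continuous_at)
    ultimately have "(\<lambda>k. ?G (l + 1 / real (Suc k))) \<longlonglongrightarrow> ?G l"
      using isCont_tendsto_compose by blast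
    then show "?G l \<le> \<phi> 1"
      using in_S by (intro LIMSEQ_le_const2) auto
  qed (use l bdd in \<open>auto intro: cInf_lower\<close>)
  then show ?thesis by (simp add: orlicz_functional_ellipsoid_of[OF T])
qed

lemma orlicz_functional_le_one_iff:
  assumes "invertible T"
  shows "orlicz_functional \<phi> K (ellipsoid_of T) \<le> 1 \<longleftrightarrow> orlicz_integral T \<le> \<phi> 1"
  using orlicz_functional_le_iff[OF assms, of 1] by simp

lemma orlicz_functional_pos:
  assumes "E \<in> ellipsoids"
  shows "orlicz_functional \<phi> K E > 0"
proof (rule ccontr)
  obtain T :: "real^'n^'n" where T: "invertible T" "E = ellipsoid_of T"
    using assms ellipsoids_iff by blast
  assume "\<not> orlicz_functional \<phi> K E > 0"
  then have le: "orlicz_functional \<phi> K (ellipsoid_of T) \<le> l" if "l > 0" for l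
    using that T(2) by simp
  have "T \<noteq> 0"
    using invertible_mult_nonzero[OF T(1), of "axis undefined 1"] by (auto simp: axis_eq_0_iff)
  then have pos: "orlicz_integral T > 0" by (rule orlicz_integral_pos)
  have \<phi>1: "\<phi> 1 > 0" by (rule Phi_pos[OF \<phi>]) simp
  \<comment> \<open>If the functional were not positive, every positive \<open>l\<close> would be
    admissible and \<open>orlicz_integral T \<le> l * \<phi> 1\<close> would hold for
    \<open>l \<le> 1\<close>. This \<open>l\<close> makes the right side at most half of the
    left.\<close>
  define l where "l = min 1 (orlicz_integral T / (2 * \<phi> 1))"
  have l: "0 < l" "l \<le> 1" using pos \<phi>1 by (auto simp: l_def)
  have "orlicz_integral T \<le> l * orlicz_integral ((1 / l) *\<^sub>R T)"
    using orlicz_integral_scale[of l "(1 / l) *\<^sub>R T"] l by simp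
  also have "\<dots> \<le> l * \<phi> 1"
    using le[OF l(1)] orlicz_functional_le_iff[OF T(1) l(1)] l by (intro mult_left_mono) auto
  also have "\<dots> \<le> orlicz_integral T / (2 * \<phi> 1) * \<phi> 1"
    using \<phi>1 by (intro mult_right_mono) (auto simp: l_def)
  also have "\<dots> = orlicz_integral T / 2" using \<phi>1 by simp
  finally show False using pos by simp
qed

text \<open>Both sides are positive and have the same positive upper bounds, so each bounds the
  other.\<close>

lemma orlicz_functional_scaleR_image:
  assumes "E \<in> ellipsoids" "c > 0"
  shows "orlicz_functional \<phi> K ((\<lambda>x. c *\<^sub>R x) ` E) = orlicz_functional \<phi> K E / c"
proof -
  obtain T :: "real^'n^'n" where T: "invertible T" "E = ellipsoid_of T"
    using assms(1) ellipsoids_iff by blast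
  let ?a = "orlicz_functional \<phi> K ((\<lambda>x. c *\<^sub>R x) ` E)" and ?b = "orlicz_functional \<phi> K E / c"
  have iff: "?a \<le> l \<longleftrightarrow> ?b \<le> l" if "l > 0" for l
  proof -
    have inv: "invertible ((1 / c) *\<^sub>R T)" using invertible_scaleR[OF T(1)] assms(2) by simp
    have "?a \<le> l \<longleftrightarrow> orlicz_integral ((1 / (l * c)) *\<^sub>R T) \<le> \<phi> 1"
      unfolding T(2) scaleR_image_ellipsoid_of[OF assms(2)] orlicz_functional_le_iff[OF inv that]
      by (simp add: mult.commute)
    also have "\<dots> \<longleftrightarrow> orlicz_functional \<phi> K E \<le> l * c"
      unfolding T(2) using that assms(2) by (intro orlicz_functional_le_iff[OF T(1), symmetric]) simp
    also have "\<dots> \<longleftrightarrow> ?b \<le> l" using assms(2) by (simp add: pos_divide_le_eq)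
    finally show ?thesis .
  qed
  have "?a > 0" using ellipsoids_scaleR_image(1)[OF assms] by (rule orlicz_functional_pos)
  moreover have "?b > 0" using orlicz_functional_pos[OF assms(1)] assms(2) by simp
  ultimately show ?thesis using iff[of ?a] iff[of ?b] by simp
qed

section \<open>Existence and uniqueness of the maximiser\<close>

lemma ex_solves_P3: "\<exists>E. solves_P3 \<phi> K E"
proof -
  let ?C = "{T. orlicz_integral T \<le> \<phi> 1}"
  have \<phi>1: "\<phi> 1 > 0" by (rule Phi_pos[OF \<phi>]) simp
  \<comment> \<open>A multiple of the identity small enough to be admissible. Its determinant is
    nonzero, which forces the maximiser over all matrices to be invertible.\<close>
  define e where "e = 1 / (1 + orlicz_integral (mat 1) / \<phi> 1)"
  have "1 + orlicz_integral (mat 1) / \<phi> 1 \<ge> 1"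
    using orlicz_integral_nonneg[of "mat 1"] \<phi>1 by simp
  then have e: "0 < e" "e \<le> 1" by (auto simp: e_def)
  have "orlicz_integral (e *\<^sub>R mat 1) \<le> e * orlicz_integral (mat 1)"
    using e by (intro orlicz_integral_scale) auto
  also have "\<dots> \<le> \<phi> 1"
    using orlicz_integral_nonneg[of "mat 1"] \<phi>1 by (simp add: e_def field_simps)
  finally have eC: "e *\<^sub>R mat 1 \<in> ?C" by simp
  obtain T where T: "T \<in> ?C" "\<And>T'. T' \<in> ?C \<Longrightarrow> \<bar>det T'\<bar> \<le> \<bar>det T\<bar>"
    using continuous_attains_sup[OF compact_orlicz_sublevel, of "\<lambda>T. \<bar>det T\<bar>"] eC
      continuous_on_rabs[OF continuous_on_det[OF continuous_on_id]] by blast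
  have "\<bar>det (e *\<^sub>R mat 1 :: real^'n^'n)\<bar> > 0" using e by (simp add: det_scaleR)
  with T(2)[OF eC] have inv: "invertible T" by (simp add: invertible_det_nz)
  have "vol_ratio F \<le> vol_ratio (ellipsoid_of T)"
    if F: "F \<in> ellipsoids" "orlicz_functional \<phi> K F \<le> 1" for F
  proof -
    obtain T' :: "real^'n^'n" where T': "invertible T'" "F = ellipsoid_of T'"
      using F(1) ellipsoids_iff by blast
    then have "\<bar>det T'\<bar> \<le> \<bar>det T\<bar>"
      using F(2) by (intro T(2)) (simp add: orlicz_functional_le_one_iff)
    then show ?thesis
      by (simp add: T'(2) vol_ratio_ellipsoid_of[OF inv] vol_ratio_ellipsoid_of[OF T'(1)])
  qed
  moreover have "orlicz_functional \<phi> K (ellipsoid_of T) \<le> 1"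
    using T(1) by (simp add: orlicz_functional_le_one_iff[OF inv])
  ultimately have "solves_P3 \<phi> K (ellipsoid_of T)"
    using inv ellipsoids_iff by (auto simp: solves_P3_def)
  then show ?thesis by blast
qed

lemma solves_P3_unique:
  assumes "solves_P3 \<phi> K E1" "solves_P3 \<phi> K E2"
  shows "E1 = E2"
proof -
  obtain T1 T2 :: "real^'n^'n" where T1: "invertible T1" "E1 = ellipsoid_of T1"
      and T2: "invertible T2" "E2 = ellipsoid_of T2"
    using assms ellipsoids_iff unfolding solves_P3_def by metis
  have max: "\<bar>det T\<bar> \<le> \<bar>det T1\<bar>" if "invertible T" "orlicz_integral T \<le> \<phi> 1" for T
  proof -
    have "ellipsoid_of T \<in> ellipsoids" using that(1) ellipsoids_iff by blast
    then have "vol_ratio (ellipsoid_of T) \<le> vol_ratio E1"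
      using assms(1) that by (simp add: solves_P3_def orlicz_functional_le_one_iff)
    then show ?thesis
      by (simp add: T1(2) vol_ratio_ellipsoid_of that(1) T1(1))
  qed
  have G: "orlicz_integral T1 \<le> \<phi> 1" "orlicz_integral T2 \<le> \<phi> 1"
    using assms T1 T2 by (simp_all add: solves_P3_def orlicz_functional_le_one_iff)
  have "vol_ratio E1 = vol_ratio E2"
    using assms unfolding solves_P3_def by (meson order_antisym)
  then have dets: "\<bar>det T1\<bar> = \<bar>det T2\<bar>"
    by (simp add: T1(2) T2(2) vol_ratio_ellipsoid_of T1(1) T2(1))
  have pos: "\<bar>det T1\<bar> > 0" using T1(1) by (simp add: invertible_det_nz)
  obtain A where A: "T1 ** A = mat 1" "A ** T1 = mat 1"
    using T1(1) by (auto simp: invertible_def)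
  define S where "S = T2 ** A"
  have ST: "S ** T1 = T2" using A(2) by (simp add: S_def flip: matrix_mul_assoc)
  then have "\<bar>det S\<bar> * \<bar>det T1\<bar> = \<bar>det T1\<bar>" using dets by (metis abs_mult det_mul)
  then have detS: "\<bar>det S\<bar> = 1" using pos by simp
  have "orthogonal_matrix S"
  proof (rule ccontr)
    assume "\<not> orthogonal_matrix S"
    then obtain Q where Q: "orthogonal_matrix Q" "\<bar>det ((1/2) *\<^sub>R (mat 1 + Q ** S))\<bar> > 1"
      using det_midpoint_gt[OF detS] by blast
    \<comment> \<open>The midpoint of \<open>T1\<close> and \<open>Q ** T2\<close>, with
      \<open>T1\<close> factored out on the right so that its determinant is read off from
      \<open>det_midpoint_gt\<close>.\<close>
    define T where "T = (1/2) *\<^sub>R (mat 1 + Q ** S) ** T1"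
    have "T = (1/2) *\<^sub>R T1 + (1/2) *\<^sub>R (Q ** T2)"
    proof -
      have "(mat 1 + Q ** S) ** T1 = T1 + Q ** (S ** T1)"
        by (simp add: matrix_mult_add_rdistrib matrix_mul_assoc)
      then show ?thesis by (simp add: T_def ST scaleR_add_right[symmetric] scalar_matrix_assoc[symmetric] del: scaleR_add_right)
    qed
    then have "orlicz_integral T \<le> (1/2) * orlicz_integral T1 + (1/2) * orlicz_integral (Q ** T2)"
      using orlicz_integral_convex[of "1/2" "1/2" T1 "Q ** T2"] by simp
    also have "\<dots> \<le> \<phi> 1" using G by (simp add: orlicz_integral_orthogonal[OF Q(1)])
    finally have GT: "orlicz_integral T \<le> \<phi> 1" .
    have gt: "\<bar>det T\<bar> > \<bar>det T1\<bar>"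
      using Q(2) pos by (simp add: T_def det_mul abs_mult)
    then have "invertible T" by (auto simp: invertible_det_nz)
    then show False using max[OF _ GT] gt by simp
  qed
  \<comment> \<open>Matrices that differ by an orthogonal factor on the left describe the same
    ellipsoid.\<close>
  then have "norm (T2 *v x) = norm (T1 *v x)" for x
    using norm_orthogonal_matrix_mult[of S "T1 *v x"] by (simp add: matrix_vector_mul_assoc ST)
  then show ?thesis by (simp add: T1(2) T2(2) ellipsoid_of_def)
qed

section \<open>Passage between the two problems by scaling\<close>

lemma solves_P2_imp_solves_P3:
  assumes "solves_P2 \<phi> K E"
  shows "solves_P3 \<phi> K ((\<lambda>x. orlicz_functional \<phi> K E *\<^sub>R x) ` E)"
proof -
  let ?o = "orlicz_functional \<phi> K"
  have E: "E \<in> ellipsoids" "vol_ratio E \<ge> 1"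
    and min: "\<And>F. F \<in> ellipsoids \<Longrightarrow> vol_ratio F \<ge> 1 \<Longrightarrow> ?o E \<le> ?o F"
    using assms by (auto simp: solves_P2_def vol_le_unit_ball_vol_iff)
  note pos = orlicz_functional_pos[OF E(1)]
  have "vol_ratio F \<le> vol_ratio E / ?o E" if F: "F \<in> ellipsoids" "?o F \<le> 1" for F
  proof -
    note vF = vol_ratio_pos[OF F(1)]
    \<comment> \<open>Dilating \<open>F\<close> by its own \<open>vol_ratio\<close> brings that
      ratio to 1, so the dilate competes with \<open>E\<close> in the minimisation problem.\<close>
    have "?o E \<le> ?o ((\<lambda>x. vol_ratio F *\<^sub>R x) ` F)"
      using vF by (intro min) (simp_all add: ellipsoids_scaleR_image[OF F(1) vF])
    also have "\<dots> = ?o F / vol_ratio F"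
      by (rule orlicz_functional_scaleR_image[OF F(1) vF])
    finally have "?o E * vol_ratio F \<le> ?o F" using vF by (simp add: pos_le_divide_eq)
    also have "\<dots> \<le> vol_ratio E" using F(2) E(2) by simp
    finally show ?thesis using pos by (simp add: pos_le_divide_eq mult.commute)
  qed
  then show ?thesis
    using pos by (simp add: solves_P3_def ellipsoids_scaleR_image[OF E(1) pos]
        orlicz_functional_scaleR_image[OF E(1) pos])
qed

lemma solves_P3_imp_solves_P2:
  assumes "solves_P3 \<phi> K E"
  shows "solves_P2 \<phi> K ((\<lambda>x. vol_ratio E *\<^sub>R x) ` E)"
proof -
  let ?o = "orlicz_functional \<phi> K"
  have E: "E \<in> ellipsoids" "?o E \<le> 1"
    and max: "\<And>F. F \<in> ellipsoids \<Longrightarrow> ?o F \<le> 1 \<Longrightarrow> vol_ratio F \<le> vol_ratio E"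
    using assms by (auto simp: solves_P3_def)
  note vE = vol_ratio_pos[OF E(1)]
  have "?o E / vol_ratio E \<le> ?o F" if F: "F \<in> ellipsoids" "vol_ratio F \<ge> 1" for F
  proof -
    note pos = orlicz_functional_pos[OF F(1)]
    \<comment> \<open>Dilating \<open>F\<close> by its own functional value brings that value to 1,
      so the dilate competes with \<open>E\<close> in the maximisation problem.\<close>
    have "vol_ratio ((\<lambda>x. ?o F *\<^sub>R x) ` F) \<le> vol_ratio E"
      using pos by (intro max)
        (simp_all add: ellipsoids_scaleR_image[OF F(1) pos] orlicz_functional_scaleR_image[OF F(1) pos])
    then have "vol_ratio F \<le> ?o F * vol_ratio E"
      using pos by (simp add: ellipsoids_scaleR_image[OF F(1) pos] pos_divide_le_eq mult.commute)
    then have "?o E \<le> ?o F * vol_ratio E" using E(2) F(2) by simp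
    then show ?thesis using vE by (simp add: pos_divide_le_eq)
  qed
  then show ?thesis
    using vE by (simp add: solves_P2_def ellipsoids_scaleR_image[OF E(1) vE]
        orlicz_functional_scaleR_image[OF E(1) vE] vol_le_unit_ball_vol_iff)
qed

end

theorem theorem4p7:
  fixes K :: "(real ^ 'n) set" and \<phi> :: "real \<Rightarrow> real"
  assumes "K \<in> star_bodies" and "\<phi> \<in> Phi_class"
  shows "(\<forall>E\<^sub>0. solves_P2 \<phi> K E\<^sub>0 \<and> (\<forall>E. solves_P2 \<phi> K E \<longrightarrow> E = E\<^sub>0) \<longrightarrow>
            solves_P3 \<phi> K ((\<lambda>x. orlicz_functional \<phi> K E\<^sub>0 *\<^sub>R x) ` E\<^sub>0))
       \<and> (\<forall>E\<^sub>1. solves_P3 \<phi> K E\<^sub>1 \<longrightarrow>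
            solves_P2 \<phi> K ((\<lambda>x. vol_ratio E\<^sub>1 *\<^sub>R x) ` E\<^sub>1))
       \<and> (\<exists>!E. solves_P3 \<phi> K E)"
proof -
  interpret orlicz_body K \<phi> by unfold_locales (fact assms)+
  show ?thesis
    using solves_P2_imp_solves_P3 solves_P3_imp_solves_P2 ex_solves_P3 solves_P3_unique by blast
qed

end
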